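(* Let $a_0\in\mathcal{E}$ be a planar central configuration which is a strong minimizer. Then the elliptic relative equilibrium of eccentricity $e$ associated with $a_0$ is hyperbolic for any $e\in[0,1)$.
   Context: Central configurations. Let $n\ge 3$, masses $m_1,\dots,m_n>0$, $U(q)=\sum_{i<j}\frac{m_im_j}{\|q_i-q_j\|}$ on $\Lambda=\{x\in(\mathbb{R}^2)^n:\ x_i\ne x_j \text{ for } i\neq j,\ \sum m_ix_i=0\}$, $\mathcal{I}(x)=\sum m_i\|x_i\|^2$, $\mathcal{E}=\{x\in\Lambda:\mathcal{I}(x)=1\}$. A planar central configuration $a_0\in\mathcal{E}$ is a critical point of $U|_{\mathcal{E}}$. With $M=\mathrm{diag}(m_1,m_1,\dots,m_n,m_n)$, the Hessian $D^2U|_{\mathcal{E}}(a_0)$ is $M^{-1}D^2U(a_0)+U(a_0)\,\mathrm{Id}$ on the tangent space of $\mathcal{E}$ at $a_0$. It has a trivial eigenvalue $0$ coming from rotation invariance; $a_0$ is called a strong minimizer if all the other (nontrivial) eigenvalues are $>U(a_0)$. Regularized Hessian. Put $k=2n-4$, $J_{2j}=\begin{pmatrix}0&-I_j\\ I_j&0\end{pmatrix}$, $\mathbb{J}_j=\mathrm{diag}(J_2,\dots,J_2)$ ($j$ copies). Choose a real $2n\times 2n$ matrix $P$ with $\mathbb{J}_nP=P\mathbb{J}_n$, $P^TMP=I_{2n}$, whose first two columns span the translation directions and whose next two columns span $\{a_0,\mathbb{J}_na_0\}$. Let $\mathcal{D}$ be the lower right $k\times k$ block of $\frac{1}{U(a_0)}P^TD^2U(a_0)P$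 and $R=I_k+\mathcal{D}$. The nontrivial eigenvalues of $D^2U|_{\mathcal{E}}(a_0)$ are $U(a_0)$ times those of $R$. Hyperbolicity. The elliptic relative equilibrium (ERE) of eccentricity $e\in[0,1)$ is the homographic solution with shape $a_0$ in which each body moves on a Keplerian ellipse of eccentricity $e$. Its linearization splits symplectically as $E_1\oplus E_2\oplus E_3$, where $E_1,E_2$ come from the translation, and dilation/rotation symmetries; the ERE is hyperbolic if the monodromy matrix restricted to $E_3$ has no eigenvalue on the unit circle. In the Meyer–Schmidt reduction (rotating coordinates, true anomaly $t$) this restricted monodromy matrix is $\gamma_e(2\pi)$, where $\dot\gamma_e=J_{2k}\mathcal{B}(t)\gamma_e$, $\gamma_e(0)=I_{2k}$, $\mathcal{B}(t)=\begin{pmatrix} I_k&-\mathbb{J}_{k/2}\\ \mathbb{J}_{k/2}& I_k-\frac{R}{1+e\cos t}\end{pmatrix}$. *)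

theory Defs
  imports "HOL-Analysis.Analysis"
begin

(* The plane R^2 is identified with the complex numbers, so that the rotation J_2 is
   multiplication by i and a configuration of CARD('n) bodies is a vector in complex^'n with its
   Euclidean inner product.  The order on 'n only serves to write the sum over i < j. *)

type_synonym 'n config = "(complex, 'n) vec"
type_synonym 'n phase = "'n config \<times> 'n config"

subsection \<open>Gradient and Hessian\<close>

definition grad :: "('v::real_inner \<Rightarrow> real) \<Rightarrow> 'v \<Rightarrow> 'v" where
  "grad f x = (THE g. GDERIV f x :> g)"

definition hessian :: "('v::real_inner \<Rightarrow> real) \<Rightarrow> 'v \<Rightarrow> 'v \<Rightarrow> 'v" where
  "hessian f x = frechet_derivative (grad f) (at x)"

subsection \<open>Central configurations\<close>

definition mass_op :: "('n::finite \<Rightarrow> real) \<Rightarrow> 'n config \<Rightarrow> 'n config" where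
  "mass_op m x = (\<chi> i. m i *\<^sub>R x $ i)"

definition mass_inv :: "('n::finite \<Rightarrow> real) \<Rightarrow> 'n config \<Rightarrow> 'n config" where
  "mass_inv m x = (\<chi> i. x $ i /\<^sub>R m i)"

(* Diagonal action of c: rotation-dilation of all bodies; c = i gives the matrix J_n. *)
definition cscale :: "complex \<Rightarrow> ('n::finite) config \<Rightarrow> 'n config" where
  "cscale c x = (\<chi> i. c * x $ i)"

definition potential :: "('n::{finite,linorder} \<Rightarrow> real) \<Rightarrow> 'n config \<Rightarrow> real" where
  "potential m x = (\<Sum>(i, j)\<in>{(i, j). i < j}. m i * m j / norm (x $ i - x $ j))"

definition inertia :: "('n::finite \<Rightarrow> real) \<Rightarrow> 'n config \<Rightarrow> real" where
  "inertia m x = (\<Sum>i\<in>UNIV. m i * (norm (x $ i))\<^sup>2)"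

definition config_space :: "('n::finite \<Rightarrow> real) \<Rightarrow> 'n config set" where
  "config_space m = {x. (\<forall>i j. i \<noteq> j \<longrightarrow> x $ i \<noteq> x $ j) \<and> (\<Sum>i\<in>UNIV. m i *\<^sub>R x $ i) = 0}"

definition inertia_ellipsoid :: "('n::finite \<Rightarrow> real) \<Rightarrow> 'n config set" where
  "inertia_ellipsoid m = {x \<in> config_space m. inertia m x = 1}"

(* Common kernel of the differentials at a of the constraints: centre of mass 0, inertia 1. *)
definition tangent_ellipsoid :: "('n::finite \<Rightarrow> real) \<Rightarrow> 'n config \<Rightarrow> 'n config set" where
  "tangent_ellipsoid m a = {v. (\<Sum>i\<in>UNIV. m i *\<^sub>R v $ i) = 0 \<and> mass_op m a \<bullet> v = 0}"

definition central_configuration :: "('n::{finite,linorder} \<Rightarrow> real) \<Rightarrow> 'n config \<Rightarrow> bool" where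
  "central_configuration m a \<longleftrightarrow>
     a \<in> inertia_ellipsoid m \<and> (\<forall>v\<in>tangent_ellipsoid m a. grad (potential m) a \<bullet> v = 0)"

(* As an operator on the tangent space of the inertia ellipsoid at a. *)
definition restricted_hessian ::
  "('n::{finite,linorder} \<Rightarrow> real) \<Rightarrow> 'n config \<Rightarrow> 'n config \<Rightarrow> 'n config" where
  "restricted_hessian m a v =
     mass_inv m (hessian (potential m) a v) + potential m a *\<^sub>R v"

(* One copy of the eigenvalue 0, with eigenvector J_n a, is trivial.  The restricted Hessian being
   self-adjoint for the mass inner product, the remaining eigenvalues (with multiplicity) are
   the ones that have an eigenvector outside the line spanned by J_n a; in particular a second
   copy of 0 counts as nontrivial. *)
definition nontrivial_eigenvalue ::
  "('n::{finite,linorder} \<Rightarrow> real) \<Rightarrow> 'n config \<Rightarrow> real \<Rightarrow> bool" where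
  "nontrivial_eigenvalue m a \<mu> \<longleftrightarrow>
     (\<exists>v\<in>tangent_ellipsoid m a. v \<notin> span {cscale \<i> a} \<and> restricted_hessian m a v = \<mu> *\<^sub>R v)"

definition strong_minimizer :: "('n::{finite,linorder} \<Rightarrow> real) \<Rightarrow> 'n config \<Rightarrow> bool" where
  "strong_minimizer m a \<longleftrightarrow>
     central_configuration m a \<and> (\<forall>\<mu>. nontrivial_eigenvalue m a \<mu> \<longrightarrow> \<mu> > potential m a)"

subsection \<open>Elliptic relative equilibria\<close>

definition newton_solution ::
  "('n::{finite,linorder} \<Rightarrow> real) \<Rightarrow> (real \<Rightarrow> 'n config) \<Rightarrow> bool" where
  "newton_solution m q \<longleftrightarrow>
     (\<exists>v. \<forall>t. (q has_vector_derivative v t) (at t) \<and>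
              (v has_vector_derivative mass_inv m (grad (potential m) (q t))) (at t))"

(* q is homographic with shape a, and the common factor runs through the ellipse
   r = p / (1 + e cos theta) of semi-latus rectum p with focus at the centre of mass;
   theta is a continuous determination of the true anomaly, 0 at time 0.  As q solves Newton's
   equations, r^2 theta' is constant, so T, where theta reaches 2 pi, is the minimal period. *)
definition elliptic_relative_equilibrium ::
  "('n::{finite,linorder} \<Rightarrow> real) \<Rightarrow> 'n config \<Rightarrow> real \<Rightarrow> real \<Rightarrow> (real \<Rightarrow> 'n config) \<Rightarrow> bool" where
  "elliptic_relative_equilibrium m a e T q \<longleftrightarrow>
     newton_solution m q \<and> T > 0 \<and>
     (\<exists>p \<theta>. p > 0 \<and> continuous_on UNIV \<theta> \<and> \<theta> 0 = 0 \<and> \<theta> T = 2 * pi \<and>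
        (\<forall>t. q t = cscale (of_real (p / (1 + e * cos (\<theta> t))) * cis (\<theta> t)) a))"

subsection \<open>Linearization and hyperbolicity\<close>

(* Newton's equations as the Hamiltonian system x' = M^-1 y, y' = grad U(x), linearized along q. *)
definition linearized_field ::
  "('n::{finite,linorder} \<Rightarrow> real) \<Rightarrow> (real \<Rightarrow> 'n config) \<Rightarrow> real \<Rightarrow> 'n phase \<Rightarrow> 'n phase" where
  "linearized_field m q t = (\<lambda>(\<xi>, \<eta>). (mass_inv m \<eta>, hessian (potential m) (q t) \<xi>))"

definition fundamental_solution ::
  "(real \<Rightarrow> 'v::real_normed_vector \<Rightarrow> 'v) \<Rightarrow> (real \<Rightarrow> 'v \<Rightarrow> 'v) \<Rightarrow> bool" where
  "fundamental_solution A \<Phi> \<longleftrightarrow>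
     (\<forall>t. linear (\<Phi> t)) \<and> (\<forall>x. \<Phi> 0 x = x) \<and>
     (\<forall>x t. ((\<lambda>s. \<Phi> s x) has_vector_derivative A t (\<Phi> t x)) (at t))"

definition symplectic_form :: "('n::finite) phase \<Rightarrow> 'n phase \<Rightarrow> real" where
  "symplectic_form X Y = fst X \<bullet> snd Y - snd X \<bullet> fst Y"

definition E1 :: "('n::finite \<Rightarrow> real) \<Rightarrow> 'n phase set" where
  "E1 m = {((\<chi> i. v), mass_op m (\<chi> i. w)) |v w. True}"

definition E2 :: "('n::finite \<Rightarrow> real) \<Rightarrow> 'n config \<Rightarrow> 'n phase set" where
  "E2 m a = {(cscale \<alpha> a, mass_op m (cscale \<beta> a)) |\<alpha> \<beta>. True}"

(* The symplectic complement of E1 + E2.  In the fixed frame the three subspaces do not depend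
   on time, since E2 is invariant under rotations and dilations. *)
definition E3 :: "('n::finite \<Rightarrow> real) \<Rightarrow> 'n config \<Rightarrow> 'n phase set" where
  "E3 m a = {X. \<forall>Y\<in>E1 m \<union> E2 m a. symplectic_form X Y = 0}"

(* F (x + i y) = c (x + i y) in the complexification of S, written in real and imaginary parts. *)
definition complex_eigenvalue_on ::
  "'v::real_vector set \<Rightarrow> ('v \<Rightarrow> 'v) \<Rightarrow> complex \<Rightarrow> bool" where
  "complex_eigenvalue_on S F c \<longleftrightarrow>
     (\<exists>x\<in>S. \<exists>y\<in>S. \<not> (x = 0 \<and> y = 0) \<and>
        F x = Re c *\<^sub>R x - Im c *\<^sub>R y \<and> F y = Im c *\<^sub>R x + Re c *\<^sub>R y)"

(* The principal fundamental solution is unique, so the quantifier over it only names it;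
   \<Phi> T is the monodromy matrix. *)
definition hyperbolic ::
  "('n::{finite,linorder} \<Rightarrow> real) \<Rightarrow> 'n config \<Rightarrow> real \<Rightarrow> (real \<Rightarrow> 'n config) \<Rightarrow> bool" where
  "hyperbolic m a T q \<longleftrightarrow>
     (\<forall>\<Phi>. fundamental_solution (linearized_field m q) \<Phi> \<longrightarrow>
        (\<forall>c. complex_eigenvalue_on (E3 m a) (\<Phi> T) c \<longrightarrow> cmod c \<noteq> 1))"

end

theory Submission
  imports Defs
begin

text \<open>
  In the fixed inertial frame the linearization along \<open>q t = c t \<cdot> a\<close> reads
  \<open>M \<xi>'' = D\<^sup>2U (q t) \<xi>\<close>, and \<open>D\<^sup>2U (c a)\<close> is \<open>D\<^sup>2U a\<close> conjugated by a rotation and scaled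
  by \<open>\<bar>c\<bar>\<^sup>-\<^sup>3\<close>. A strong minimizer has \<open>D\<^sup>2U a\<close> positive definite on the mass-orthogonal complement
  of the translations, \<open>a\<close> and \<open>i a\<close>, in which the motions starting in \<open>E3\<close> remain. Along these,
  \<open>(\<xi> \<bullet> M \<xi>')' = \<xi>' \<bullet> M \<xi>' + \<xi> \<bullet> D\<^sup>2U (q t) \<xi> > 0\<close>. For an eigenvector of the monodromy with
  eigenvalue on the unit circle the Hermitian version of \<open>\<xi> \<bullet> M \<xi>'\<close> would return to its initial value.
\<close>

subsection \<open>The Hessian of the Newtonian potential\<close>

definition newton_force :: "'v::real_inner \<Rightarrow> 'v" where
  "newton_force d = - (1 / norm d ^ 3) *\<^sub>R d"

definition tidal :: "'v::real_inner \<Rightarrow> 'v \<Rightarrow> 'v" where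
  "tidal d w = (3 * (d \<bullet> w) / norm d ^ 5) *\<^sub>R d - (1 / norm d ^ 3) *\<^sub>R w"

lemma has_derivative_inverse_norm:
  fixes d :: "'v::real_inner"
  assumes "d \<noteq> 0"
  shows "((\<lambda>x. 1 / norm x) has_derivative (\<lambda>h. h \<bullet> newton_force d)) (at d)"
  using assms
  by (auto intro!: derivative_eq_intros has_derivative_norm
      simp: newton_force_def sgn_div_norm power3_eq_cube inner_commute field_simps)

lemma has_derivative_newton_force:
  fixes d :: "'v::real_inner"
  assumes "d \<noteq> 0"
  shows "(newton_force has_derivative tidal d) (at d)"
proof -
  have "((\<lambda>x. - (1 / norm x ^ 3) *\<^sub>R x) has_derivative tidal d) (at d)"
    using assms
    by (auto intro!: derivative_eq_intros has_derivative_norm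
        simp: tidal_def sgn_div_norm inner_commute divide_simps eval_nat_numeral)
  then show ?thesis
    by (simp add: newton_force_def[abs_def])
qed

lemma newton_force_minus: "newton_force (- d) = - newton_force d"
  by (simp add: newton_force_def)

lemma tidal_minus: "tidal (- d) (- w) = - tidal d w"
  by (simp add: tidal_def)

lemma tidal_zero [simp]: "tidal d 0 = 0"
  by (simp add: tidal_def)

lemma linear_tidal: "linear (tidal d)"
  by (rule linearI) (auto simp: tidal_def algebra_simps inner_add_right add_divide_distrib)

lemma tidal_symmetric: "tidal d v \<bullet> w = tidal d w \<bullet> v"
  by (simp add: tidal_def inner_diff_left inner_diff_right inner_commute)

text \<open>Euler's identity for \<open>newton_force\<close>, which is homogeneous of degree -2. At
  \<open>d = 0\<close> both sides vanish by the convention for division by zero.\<close>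

lemma tidal_self: "tidal d d = - 2 *\<^sub>R newton_force d"
proof (cases "d = 0")
  case False
  then have "3 * (d \<bullet> d) / norm d ^ 5 = 3 / norm d ^ 3"
    by (simp add: dot_square_norm divide_simps flip: power_add)
  then show ?thesis
    by (simp add: tidal_def newton_force_def flip: scaleR_left_diff_distrib)
qed (simp add: newton_force_def)

lemma complex_inner_cscale: "(c * x) \<bullet> (c * y) = (cmod c)\<^sup>2 * (x \<bullet> y)" for c x y :: complex
  unfolding inner_complex_def cmod_power2 by (simp add: power2_eq_square algebra_simps)

text \<open>Infinitesimal rotation equivariance of the force: \<open>\<i> * d\<close> is orthogonal
  to \<open>d\<close>, so only the multiple of the identity in \<open>tidal\<close>
  survives.\<close>

lemma tidal_rotate: "tidal d (\<i> * d) = \<i> * newton_force d" for d :: complex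
  by (simp add: tidal_def newton_force_def inner_complex_def)

text \<open>The rotation part of \<open>c\<close> conjugates the tensor and the dilation part
  contributes the power -3 of \<open>cmod c\<close>; the factor
  \<open>c / of_real (cmod c ^ 3)\<close> records both at once.\<close>

lemma tidal_cscale:
  fixes c d w :: complex
  assumes "c \<noteq> 0"
  shows "tidal (c * d) (c * w) = (c / of_real (cmod c ^ 3)) * tidal d w"
proof -
  have "3 * ((c * d) \<bullet> (c * w)) / norm (c * d) ^ 5 = (1 / cmod c ^ 3) * (3 * (d \<bullet> w) / norm d ^ 5)"
    using assms by (simp add: complex_inner_cscale norm_mult power_mult_distrib divide_simps flip: power_add)
  then show ?thesis
    unfolding tidal_def
    by (simp add: norm_mult power_mult_distrib scaleR_conv_of_real algebra_simps)
qed

section \<open>From pair interactions to the gradient and Hessian of the full potential\<close>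

lemma sum_pairs_split:
  fixes g :: "'n::{finite,linorder} \<Rightarrow> 'n \<Rightarrow> 'a::comm_monoid_add"
  assumes "\<And>i. g i i = 0"
  shows "(\<Sum>i\<in>UNIV. \<Sum>j\<in>UNIV. g i j) = (\<Sum>(i, j)\<in>{(i, j). i < j}. g i j + g j i)"
proof -
  have U: "UNIV = {(i, j). i < j} \<union> ({(i, j). j < i} \<union> {(i, j :: 'n). i = j})"
    by auto
  have "(\<Sum>i\<in>UNIV. \<Sum>j\<in>UNIV. g i j) = (\<Sum>(i, j)\<in>UNIV. g i j)"
    by (simp add: sum.cartesian_product)
  also have "\<dots> = (\<Sum>(i, j)\<in>{(i, j). i < j}. g i j) + ((\<Sum>(i, j)\<in>{(i, j). j < i}. g i j)
      + (\<Sum>(i, j)\<in>{(i, j). i = j}. g i j))"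
    by (subst U, subst sum.union_disjoint, (auto)[3], subst sum.union_disjoint) auto
  also have "(\<Sum>(i, j)\<in>{(i, j). i = j}. g i j) = 0"
    by (rule sum.neutral) (auto simp: assms)
  also have "(\<Sum>(i, j)\<in>{(i, j). j < i}. g i j) = (\<Sum>(i, j)\<in>{(i, j). i < j}. g j i)"
    by (rule sum.reindex_bij_witness[of _ prod.swap prod.swap]) auto
  finally show ?thesis
    by (simp add: case_prod_unfold sum.distrib)
qed

text \<open>Newton's third law in weak form: the terms of \<open>(i, j)\<close> and
  \<open>(j, i)\<close> combine into one that sees only the relative displacement. Translation
  invariance and the symmetry of the Hessian are read off from this.\<close>

lemma sum_antisymmetric_inner:
  fixes G :: "'n::{finite,linorder} \<Rightarrow> 'n \<Rightarrow> 'v::real_inner"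
  assumes "\<And>i j. G j i = - G i j"
  shows "(\<chi> i. \<Sum>j\<in>UNIV. G i j) \<bullet> h = (\<Sum>(i, j)\<in>{(i, j). i < j}. G i j \<bullet> (h $ i - h $ j))"
proof -
  have "G i i = 0" for i
  proof -
    have "G i i + G i i = 0"
      by (subst (2) assms) simp
    then show ?thesis
      by (simp flip: scaleR_2)
  qed
  moreover have "(\<chi> i. \<Sum>j\<in>UNIV. G i j) \<bullet> h = (\<Sum>i\<in>UNIV. \<Sum>j\<in>UNIV. G i j \<bullet> h $ i)"
    by (simp add: inner_vec_def inner_sum_left)
  moreover have "G i j \<bullet> h $ i + G j i \<bullet> h $ j = G i j \<bullet> (h $ i - h $ j)" for i j
    using assms[where i = i and j = j] by (simp add: inner_diff_right)
  ultimately show ?thesis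
    by (simp add: sum_pairs_split)
qed

text \<open>In \<open>force\<close> and \<open>hess\<close> the diagonal terms are 0 because of the junk value \<open>1 / 0 = 0\<close>.\<close>

definition force :: "('n::finite \<Rightarrow> real) \<Rightarrow> 'n config \<Rightarrow> 'n config" where
  "force m x = (\<chi> i. \<Sum>j\<in>UNIV. (m i * m j) *\<^sub>R newton_force (x $ i - x $ j))"

definition hess :: "('n::finite \<Rightarrow> real) \<Rightarrow> 'n config \<Rightarrow> 'n config \<Rightarrow> 'n config" where
  "hess m x v = (\<chi> i. \<Sum>j\<in>UNIV. (m i * m j) *\<^sub>R tidal (x $ i - x $ j) (v $ i - v $ j))"

definition collision_free :: "('n::finite) config set" where
  "collision_free = {x. \<forall>i j. i \<noteq> j \<longrightarrow> x $ i \<noteq> x $ j}"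

lemma force_inner:
  "force m x \<bullet> h = (\<Sum>(i, j)\<in>{(i, j). i < j}.
     (m i * m j) * (newton_force (x $ i - x $ j) \<bullet> (h $ i - h $ j)))"
  for m :: "'n::{finite,linorder} \<Rightarrow> real"
proof -
  have "(m j * m i) *\<^sub>R newton_force (x $ j - x $ i)
      = - ((m i * m j) *\<^sub>R newton_force (x $ i - x $ j))" for i j
    using newton_force_minus[of "x $ i - x $ j"] by (simp add: mult.commute)
  from sum_antisymmetric_inner[of "\<lambda>i j. (m i * m j) *\<^sub>R newton_force (x $ i - x $ j)", OF this]
  show ?thesis
    by (simp add: force_def)
qed

lemma hess_inner:
  "hess m x v \<bullet> h = (\<Sum>(i, j)\<in>{(i, j). i < j}.
     (m i * m j) * (tidal (x $ i - x $ j) (v $ i - v $ j) \<bullet> (h $ i - h $ j)))"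
  for m :: "'n::{finite,linorder} \<Rightarrow> real"
proof -
  have "(m j * m i) *\<^sub>R tidal (x $ j - x $ i) (v $ j - v $ i)
      = - ((m i * m j) *\<^sub>R tidal (x $ i - x $ j) (v $ i - v $ j))" for i j
    using tidal_minus[of "x $ i - x $ j" "v $ i - v $ j"] by (simp add: mult.commute)
  from sum_antisymmetric_inner[of "\<lambda>i j. (m i * m j) *\<^sub>R tidal (x $ i - x $ j) (v $ i - v $ j)", OF this]
  show ?thesis
    by (simp add: hess_def)
qed

lemma hess_symmetric: "hess m x v \<bullet> h = v \<bullet> hess m x h"
  for m :: "'n::{finite,linorder} \<Rightarrow> real"
proof -
  have "hess m x v \<bullet> h = hess m x h \<bullet> v"
    unfolding hess_inner by (simp only: tidal_symmetric[of _ "v $ i - v $ j" for i j])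
  then show ?thesis
    by (simp add: inner_commute)
qed

lemma linear_hess: "linear (hess m x)"
proof (rule linearI)
  show "hess m x (v + w) = hess m x v + hess m x w" for v w
    by (simp add: hess_def vec_eq_iff add_diff_add linear_add[OF linear_tidal]
        scaleR_add_right sum.distrib)
  show "hess m x (c *\<^sub>R v) = c *\<^sub>R hess m x v" for c v
    by (simp add: hess_def vec_eq_iff linear_cmul[OF linear_tidal] scaleR_sum_right mult.commute
        flip: scaleR_diff_right)
qed

lemma open_collision_free: "open (collision_free :: ('n::finite) config set)"
proof -
  have "collision_free = (\<Inter>i. \<Inter>j\<in>-{i}. {x :: 'n config. x $ i \<noteq> x $ j})"
    by (auto simp: collision_free_def)
  also have "open \<dots>"
    by (intro open_INT ballI finite open_Collect_neq continuous_intros)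
  finally show ?thesis .
qed

lemma potential_gderiv:
  assumes "x \<in> collision_free"
  shows "GDERIV (potential m) x :> force m x"
  unfolding gderiv_def inner_commute[of _ "force m x"] force_inner
  unfolding potential_def[abs_def] case_prod_unfold
proof (rule has_derivative_sum)
  fix p assume "p \<in> {p :: 'a \<times> 'a. fst p < snd p}"
  then have "x $ fst p - x $ snd p \<noteq> 0"
    using assms by (auto simp: collision_free_def)
  moreover have "((\<lambda>x. x $ fst p - x $ snd p) has_derivative (\<lambda>h. h $ fst p - h $ snd p)) (at x)"
    by (intro bounded_linear_imp_has_derivative bounded_linear_sub bounded_linear_vec_nth)
  ultimately have "((\<lambda>x. 1 / norm (x $ fst p - x $ snd p)) has_derivative
      (\<lambda>h. (h $ fst p - h $ snd p) \<bullet> newton_force (x $ fst p - x $ snd p))) (at x)"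
    using has_derivative_compose[OF _ has_derivative_inverse_norm] by blast
  from has_derivative_mult_right[OF this, of "m (fst p) * m (snd p)"]
  show "((\<lambda>x. m (fst p) * m (snd p) / norm (x $ fst p - x $ snd p)) has_derivative
     (\<lambda>h. m (fst p) * m (snd p) * (newton_force (x $ fst p - x $ snd p)
        \<bullet> (h $ fst p - h $ snd p)))) (at x)"
    by (simp add: inner_commute)
qed

lemma grad_eq:
  assumes "GDERIV f x :> g"
  shows "grad f x = g"
  unfolding grad_def
proof (rule the_equality)
  fix g' assume "GDERIV f x :> g'"
  then have "(\<lambda>h. h \<bullet> g') = (\<lambda>h. h \<bullet> g)"
    using assms unfolding gderiv_def by (rule has_derivative_unique)
  then show "g' = g"
    by (metis inner_commute vector_eq_ldot)
qed (fact assms)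

lemma grad_potential:
  assumes "x \<in> collision_free"
  shows "grad (potential m) x = force m x"
  using assms by (intro grad_eq potential_gderiv)

lemma has_derivative_force:
  assumes "x \<in> collision_free"
  shows "(force m has_derivative hess m x) (at x)"
  unfolding has_derivative_componentwise_within[of "force m"]
proof
  fix b :: "'a config" assume "b \<in> Basis"
  then obtain i u where b: "b = axis i u"
    by (auto simp: Basis_vec_def)
  have "((\<lambda>x. (m i * m j) *\<^sub>R newton_force (x $ i - x $ j)) has_derivative
      (\<lambda>v. (m i * m j) *\<^sub>R tidal (x $ i - x $ j) (v $ i - v $ j))) (at x)" for j
  proof (cases "i = j")
    case False
    then have "x $ i - x $ j \<noteq> 0"
      using assms by (auto simp: collision_free_def)
    moreover have "((\<lambda>x. x $ i - x $ j) has_derivative (\<lambda>h. h $ i - h $ j)) (at x)"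
      by (intro bounded_linear_imp_has_derivative bounded_linear_sub bounded_linear_vec_nth)
    ultimately show ?thesis
      by (intro has_derivative_scaleR_right has_derivative_compose[OF _ has_derivative_newton_force])
  qed simp
  then have "((\<lambda>x. \<Sum>j\<in>UNIV. (m i * m j) *\<^sub>R newton_force (x $ i - x $ j)) has_derivative
      (\<lambda>v. \<Sum>j\<in>UNIV. (m i * m j) *\<^sub>R tidal (x $ i - x $ j) (v $ i - v $ j))) (at x)"
    by (intro has_derivative_sum)
  then show "((\<lambda>x. force m x \<bullet> b) has_derivative (\<lambda>v. hess m x v \<bullet> b)) (at x)"
    by (simp add: b inner_axis force_def hess_def has_derivative_inner_left)
qed

lemma hessian_potential:
  assumes "x \<in> collision_free"
  shows "hessian (potential m) x = hess m x"
proof -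
  \<comment> \<open>The gradient is known to equal \<open>force\<close> only away from collisions;
    since \<open>collision_free\<close> is open, the derivative still transfers.\<close>
  have "(grad (potential m) has_derivative hess m x) (at x)"
    using has_derivative_transform_within_open[OF has_derivative_force[OF assms, of m] open_collision_free assms]
    by (simp add: grad_potential)
  then show ?thesis
    unfolding hessian_def by (metis frechet_derivative_at)
qed

lemma hess_self: "hess m x x = - 2 *\<^sub>R force m x"
  by (simp only: hess_def force_def tidal_self vec_eq_iff vec_lambda_beta vector_scaleR_component
      scaleR_sum_right scaleR_left_commute[of _ "- 2"]) simp

lemma hess_rotate: "hess m x (cscale \<i> x) = cscale \<i> (force m x)"
  by (simp add: hess_def force_def cscale_def tidal_rotate vec_eq_iff sum_distrib_left
      flip: right_diff_distrib)

lemma hess_cscale: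
  assumes "c \<noteq> 0"
  shows "hess m (cscale c x) (cscale c v) = cscale (c / of_real (cmod c ^ 3)) (hess m x v)"
  by (simp add: hess_def cscale_def vec_eq_iff tidal_cscale[OF assms] sum_distrib_left mult.left_commute
      scaleR_conv_of_real flip: right_diff_distrib)

lemma hess_translation: "hess m x (\<chi> i. v) = 0"
  by (simp add: hess_def vec_eq_iff)

text \<open>Conservation of momentum: paired with a translation, the force only meets displacement
  differences equal to 0.\<close>

lemma sum_force: "(\<Sum>i\<in>UNIV. force m x $ i) = 0"
  for m :: "'n::{finite,linorder} \<Rightarrow> real"
proof -
  have "(\<Sum>i\<in>UNIV. force m x $ i) \<bullet> v = force m x \<bullet> (\<chi> i. v)" for v
    by (simp add: inner_vec_def inner_sum_left)
  also have "force m x \<bullet> (\<chi> i. v) = 0" for v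
    by (simp add: force_inner)
  finally show ?thesis
    by (metis inner_eq_zero_iff)
qed

subsection \<open>Positivity of the Hessian at a strong minimizer\<close>

text \<open>A null vector of a nonnegative form lies in its radical: were
  \<open>C v \<bullet> w\<close> nonzero, a small step from \<open>v\<close> along \<open>w\<close>
  or its opposite would make the form negative.\<close>

lemma semidefinite_kernel:
  fixes C :: "'v::real_inner \<Rightarrow> 'v"
  assumes "linear C" and sym: "\<And>v w. C v \<bullet> w = v \<bullet> C w"
    and "subspace W" and nonneg: "\<And>w. w \<in> W \<Longrightarrow> 0 \<le> C w \<bullet> w"
    and "v \<in> W" "C v \<bullet> v = 0" "w \<in> W"
  shows "C v \<bullet> w = 0"
proof (rule ccontr)
  assume nz: "C v \<bullet> w \<noteq> 0"
  define b N where "b = C v \<bullet> w" and "N = C w \<bullet> w"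
  have quad: "0 \<le> 2 * s * b + s\<^sup>2 * N" for s
  proof -
    have "v + s *\<^sub>R w \<in> W"
      using assms by (auto intro: subspace_add subspace_scale)
    from nonneg[OF this] have "0 \<le> (C v + s *\<^sub>R C w) \<bullet> (v + s *\<^sub>R w)"
      using \<open>linear C\<close> by (simp add: linear_add linear_cmul)
    also have "\<dots> = C v \<bullet> v + s * (C v \<bullet> w) + s * (C w \<bullet> v) + s\<^sup>2 * (C w \<bullet> w)"
      by (simp add: inner_add_left inner_add_right algebra_simps power2_eq_square)
    also have "C w \<bullet> v = C v \<bullet> w"
      by (metis sym inner_commute)
    finally show ?thesis
      using assms by (simp add: b_def N_def)
  qed
  have "N \<ge> 0"
    using nonneg assms by (simp add: N_def)
  \<comment> \<open>The minimizing step would be \<open>- b / N\<close>; the denominator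
    \<open>N + 1\<close> also covers \<open>N = 0\<close> and still gives a negative value.\<close>
  define s where "s = - b / (N + 1)"
  have "2 * s * b + s\<^sup>2 * N = - (b\<^sup>2 * (N + 2) / (N + 1)\<^sup>2)"
    using \<open>N \<ge> 0\<close> by (simp add: s_def divide_simps) (simp add: power2_eq_square algebra_simps)
  also have "\<dots> < 0"
    using \<open>N \<ge> 0\<close> nz by (simp add: b_def)
  finally show False
    using quad[of s] by simp
qed

text \<open>A minimizer of the Rayleigh quotient on the invariant subspace is an eigenvector.\<close>

lemma positive_definite_if_eigenvalues_positive:
  fixes H B :: "'v::euclidean_space \<Rightarrow> 'v"
  assumes linH: "linear H" and symH: "\<And>v w. H v \<bullet> w = v \<bullet> H w"
    and linB: "linear B" and symB: "\<And>v w. B v \<bullet> w = v \<bullet> B w"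
    and posB: "\<And>v. v \<noteq> 0 \<Longrightarrow> 0 < B v \<bullet> v"
    and W: "subspace W" and inv: "\<And>w. w \<in> W \<Longrightarrow> \<exists>u\<in>W. H w = B u"
    and eig: "\<And>v \<kappa>. v \<in> W \<Longrightarrow> v \<noteq> 0 \<Longrightarrow> H v = \<kappa> *\<^sub>R B v \<Longrightarrow> 0 < \<kappa>"
    and w: "w \<in> W" "w \<noteq> 0"
  shows "0 < H w \<bullet> w"
proof -
  define Q where "Q v = (H v \<bullet> v) / (B v \<bullet> v)" for v
  let ?\<Sigma> = "W \<inter> sphere 0 1"
  have "compact ?\<Sigma>"
    using W by (intro closed_Int_compact closed_subspace) auto
  moreover have unit: "x /\<^sub>R norm x \<in> ?\<Sigma>" if "x \<in> W" "x \<noteq> 0" for x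
    using that W by (auto simp: subspace_scale)
  moreover have "continuous_on ?\<Sigma> Q"
  proof -
    have "\<forall>x\<in>?\<Sigma>. B x \<bullet> x \<noteq> 0"
      using posB by (metis IntD2 less_irrefl mem_sphere_0 norm_zero zero_neq_one)
    then show ?thesis
      unfolding Q_def
      by (intro continuous_intros linear_continuous_on_compose[OF _ linH]
          linear_continuous_on_compose[OF _ linB]) auto
  qed
  ultimately obtain v where v: "v \<in> ?\<Sigma>" and min: "\<And>x. x \<in> ?\<Sigma> \<Longrightarrow> Q v \<le> Q x"
    using continuous_attains_inf[of ?\<Sigma> Q] w by blast
  have v0: "v \<noteq> 0" and vW: "v \<in> W"
    using v by auto
  \<comment> \<open>By minimality of \<open>Q v\<close>, the form of \<open>C\<close> is nonnegative
    on \<open>W\<close> and vanishes at \<open>v\<close>, so \<open>semidefinite_kernel\<close>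
    makes \<open>C v\<close> orthogonal to \<open>W\<close>.\<close>
  define C where "C x = H x - Q v *\<^sub>R B x" for x
  have Qle: "Q v \<le> Q x" if "x \<in> W" "x \<noteq> 0" for x
  proof -
    have "Q (x /\<^sub>R norm x) = Q x"
      using that by (simp add: Q_def linear_cmul linH linB)
    with min[OF unit[OF that]] show ?thesis
      by simp
  qed
  have "Q v * (B x \<bullet> x) \<le> H x \<bullet> x" if "x \<in> W" "x \<noteq> 0" for x
    using Qle[OF that] posB[OF that(2)] by (simp add: Q_def[of x] pos_le_divide_eq)
  then have nonneg: "0 \<le> C x \<bullet> x" if "x \<in> W" for x
    using that by (cases "x = 0") (auto simp: C_def inner_diff_left)
  have "C v \<bullet> v = 0"
    using posB[OF v0] by (simp add: C_def Q_def inner_diff_left)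
  moreover have "linear C"
    unfolding C_def using linH linB by (intro linear_compose_sub linear_compose_scale_right)
  moreover have "C x \<bullet> y = x \<bullet> C y" for x y
    by (simp add: C_def inner_diff_left inner_diff_right symH symB)
  ultimately have orth: "C v \<bullet> x = 0" if "x \<in> W" for x
    using semidefinite_kernel[of C W] W nonneg vW that by blast
  \<comment> \<open>Orthogonality to \<open>W\<close> alone does not give \<open>C v = 0\<close>.
    Invariance writes \<open>C v\<close> as \<open>B\<close> of a vector of \<open>W\<close>;
    pairing with that vector and definiteness of \<open>B\<close> force it to be 0.\<close>
  obtain u where u: "u \<in> W" "H v = B u"
    using inv[OF vW] by blast
  then have "C v = B (u - Q v *\<^sub>R v)" "u - Q v *\<^sub>R v \<in> W"
    using W vW by (auto simp: C_def linear_diff linear_cmul linB subspace_diff subspace_scale)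
  with orth posB have "u - Q v *\<^sub>R v = 0"
    by (metis less_irrefl)
  then have "H v = Q v *\<^sub>R B v"
    using u by (simp add: linear_cmul linB)
  then have "0 < Q v"
    using eig v0 vW by blast
  also have "Q v \<le> Q w"
    by (rule Qle[OF w])
  finally show ?thesis
    using posB[OF w(2)] by (simp add: Q_def zero_less_divide_iff)
qed

text \<open>Gronwall with an integrating factor:
  \<open>exp (- 2 * K * s) * (X s \<bullet> X s)\<close> is nonnegative, nonincreasing and starts at
  0. It will show that components along \<open>a\<close> and \<open>cscale \<i> a\<close> stay
  zero.\<close>

lemma gronwall_zero:
  fixes X :: "real \<Rightarrow> 'v::real_inner"
  assumes deriv: "\<And>t. (X has_vector_derivative D t) (at t)"
    and bound: "\<And>t. norm (D t) \<le> K * norm (X t)"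
    and "X 0 = 0" "0 \<le> t"
  shows "X t = 0"
proof -
  define g where "g s = exp (- 2 * K * s) * (X s \<bullet> X s)" for s
  have "(g has_real_derivative exp (- 2 * K * s) * (2 * (X s \<bullet> D s) - 2 * K * (X s \<bullet> X s))) (at s)" for s
  proof -
    have "((\<lambda>s. X s \<bullet> X s) has_real_derivative 2 * (X s \<bullet> D s)) (at s)"
      using bounded_bilinear.has_vector_derivative[OF bounded_bilinear_inner deriv deriv, of s]
      by (simp add: has_real_derivative_iff_has_vector_derivative inner_commute)
    then show ?thesis
      unfolding g_def by (auto intro!: derivative_eq_intros simp: algebra_simps)
  qed
  moreover have "exp (- 2 * K * s) * (2 * (X s \<bullet> D s) - 2 * K * (X s \<bullet> X s)) \<le> 0" for s
  proof -
    have "X s \<bullet> D s \<le> norm (X s) * norm (D s)"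
      by (rule norm_cauchy_schwarz)
    also have "\<dots> \<le> norm (X s) * (K * norm (X s))"
      by (intro mult_left_mono bound) simp
    finally show ?thesis
      by (simp add: mult_le_0_iff dot_square_norm power2_eq_square mult.left_commute)
  qed
  ultimately have "g t \<le> g 0"
    using \<open>0 \<le> t\<close> by (intro DERIV_nonpos_imp_nonincreasing[of 0 t g]) blast+
  then show ?thesis
    using \<open>X 0 = 0\<close> by (simp add: g_def mult_le_0_iff dot_square_norm)
qed

section \<open>Translations, dilations and rotations, and their mass-orthogonal complement\<close>

definition symmetry_space :: "('n::finite) config \<Rightarrow> 'n config set" where
  "symmetry_space a = {(\<chi> i. v) + cscale \<alpha> a |v \<alpha>. True}"

definition shape_space :: "('n::finite \<Rightarrow> real) \<Rightarrow> 'n config \<Rightarrow> 'n config set" where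
  "shape_space m a = {x. \<forall>y\<in>symmetry_space a. mass_op m x \<bullet> y = 0}"

lemma linear_mass_op: "linear (mass_op m)"
  by (rule linearI) (auto simp: mass_op_def vec_eq_iff scaleR_add_right)

lemma linear_cscale: "linear (cscale c)"
  by (rule linearI) (auto simp: cscale_def vec_eq_iff algebra_simps)

lemma mass_op_symmetric: "mass_op m x \<bullet> y = x \<bullet> mass_op m y"
  by (simp add: mass_op_def inner_vec_def)

lemma cscale_0 [simp]: "cscale 0 x = 0"
  by (simp add: cscale_def vec_eq_iff)

lemma cscale_1 [simp]: "cscale 1 x = x"
  by (simp add: cscale_def vec_eq_iff)

lemma cscale_cscale: "cscale c (cscale d x) = cscale (c * d) x"
  by (simp add: cscale_def vec_eq_iff)

lemma cscale_add: "cscale (c + d) x = cscale c x + cscale d x"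
  by (simp add: cscale_def vec_eq_iff algebra_simps)

lemma cscale_of_real: "cscale (of_real r) x = r *\<^sub>R x"
  by (simp add: cscale_def vec_eq_iff flip: scaleR_conv_of_real)

lemma cscale_of_real_mult: "cscale (of_real r * c) x = r *\<^sub>R cscale c x"
  by (simp flip: cscale_of_real cscale_cscale)

lemma cscale_decompose: "cscale c x = Re c *\<^sub>R x + Im c *\<^sub>R cscale \<i> x"
proof -
  have "cscale c x = cscale (of_real (Re c) + of_real (Im c) * \<i>) x"
    by (simp add: mult.commute flip: complex_eq)
  then show ?thesis
    by (simp only: cscale_add cscale_of_real cscale_of_real_mult)
qed

lemma mass_op_cscale: "mass_op m (cscale c x) = cscale c (mass_op m x)"
  by (simp add: mass_op_def cscale_def vec_eq_iff)

lemma inner_cscale: "cscale c x \<bullet> cscale c y = (cmod c)\<^sup>2 * (x \<bullet> y)"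
  by (simp add: inner_vec_def cscale_def complex_inner_cscale sum_distrib_left)

lemma subspace_shape_space: "subspace (shape_space m a)"
  by (rule subspaceI)
    (auto simp: shape_space_def linear_0 linear_add linear_cmul linear_mass_op inner_add_left)

lemma cscale_symmetry_space: "y \<in> symmetry_space a \<Longrightarrow> cscale c y \<in> symmetry_space a"
proof -
  assume "y \<in> symmetry_space a"
  then obtain v \<alpha> where "y = (\<chi> i. v) + cscale \<alpha> a"
    by (auto simp: symmetry_space_def)
  then have "cscale c y = (\<chi> i. c * v) + cscale (c * \<alpha>) a"
    by (simp add: linear_add[OF linear_cscale] cscale_cscale) (simp add: cscale_def)
  then show ?thesis
    by (auto simp: symmetry_space_def)
qed

text \<open>\<open>cscale c\<close> multiplies the mass inner product by the square of
  \<open>cmod c\<close> and preserves \<open>symmetry_space\<close>, hence also its complement. So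
  one and the same space serves for all configurations \<open>cscale c a\<close>.\<close>

lemma cscale_shape_space:
  assumes "x \<in> shape_space m a"
  shows "cscale c x \<in> shape_space m a"
proof (cases "c = 0")
  case True
  then show ?thesis
    using subspace_0[OF subspace_shape_space] by simp
next
  case False
  have "mass_op m (cscale c x) \<bullet> y = 0" if "y \<in> symmetry_space a" for y
  proof -
    have "mass_op m (cscale c x) \<bullet> y = cscale c (mass_op m x) \<bullet> cscale c (cscale (1 / c) y)"
      using False by (simp add: mass_op_cscale cscale_cscale)
    also have "\<dots> = 0"
      using assms cscale_symmetry_space[OF that] by (simp add: inner_cscale shape_space_def)
    finally show ?thesis .
  qed
  then show ?thesis
    by (simp add: shape_space_def)
qed

section \<open>The central configuration equation and the Hessian along the symmetry
  directions\<close>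

context
  fixes m :: "'n::{finite,linorder} \<Rightarrow> real"
  assumes m: "\<And>i. m i > 0"
begin

lemma mass_op_inv: "mass_op m (mass_inv m x) = x" "mass_inv m (mass_op m x) = x"
  using m by (simp_all add: mass_op_def mass_inv_def vec_eq_iff less_imp_neq[THEN not_sym])

lemma mass_op_pos: "x \<noteq> 0 \<Longrightarrow> 0 < mass_op m x \<bullet> x"
proof -
  assume "x \<noteq> 0"
  then obtain i where "x $ i \<noteq> 0"
    by (auto simp: vec_eq_iff)
  then show ?thesis
    using m unfolding inner_vec_def mass_op_def
    by (intro sum_pos2[of _ i]) (auto simp: less_imp_le)
qed

lemma mass_inv_nonneg: "0 \<le> mass_inv m x \<bullet> x"
  using m by (auto simp: inner_vec_def mass_inv_def less_imp_le intro!: sum_nonneg)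

lemma mass_inv_pos: "x \<noteq> 0 \<Longrightarrow> 0 < mass_inv m x \<bullet> x"
  by (metis mass_op_inv(1) inner_commute linear_0 linear_mass_op mass_op_pos)

lemma mass_inv_inner_mass_op: "mass_inv m x \<bullet> mass_op m y = x \<bullet> y"
  by (metis mass_op_inv(1) mass_op_symmetric)

context
  fixes a :: "'n config"
  assumes cc: "central_configuration m a"
begin

lemma collision_free_cc: "a \<in> collision_free"
  using cc by (auto simp: central_configuration_def inertia_ellipsoid_def config_space_def collision_free_def)

lemma collision_free_cscale: "c \<noteq> 0 \<Longrightarrow> cscale c a \<in> collision_free"
  using collision_free_cc by (auto simp: collision_free_def cscale_def)

text \<open>The Lagrange multiplier of the constraint \<open>inertia m x = 1\<close>, up to
  normalization; by Euler's identity its value is \<open>- potential m a\<close>.\<close>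

abbreviation multiplier :: real where
  "multiplier \<equiv> force m a \<bullet> a"

lemma force_cc: "force m a = multiplier *\<^sub>R mass_op m a"
proof -
  have centred: "(\<Sum>i\<in>UNIV. m i *\<^sub>R a $ i) = 0"
    using cc by (auto simp: central_configuration_def inertia_ellipsoid_def config_space_def)
  have unit: "mass_op m a \<bullet> a = 1"
    using cc by (auto simp: central_configuration_def inertia_ellipsoid_def inertia_def mass_op_def
        inner_vec_def dot_square_norm)
  \<comment> \<open>The tangential part of the mass gradient of the potential. It is centred because
    the forces sum to 0 and orthogonal to \<open>a\<close> because the inertia is 1; criticality
    then makes its mass norm vanish.\<close>
  define v where "v = mass_inv m (force m a) - multiplier *\<^sub>R a"
  have v: "mass_op m v = force m a - multiplier *\<^sub>R mass_op m a"
    by (simp add: v_def linear_diff linear_cmul linear_mass_op mass_op_inv)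
  have "(\<Sum>i\<in>UNIV. m i *\<^sub>R v $ i) = (\<Sum>i\<in>UNIV. mass_op m v $ i)"
    by (simp add: mass_op_def)
  also have "\<dots> = (\<Sum>i\<in>UNIV. force m a $ i) - multiplier *\<^sub>R (\<Sum>i\<in>UNIV. m i *\<^sub>R a $ i)"
    unfolding v by (simp add: sum_subtractf scaleR_sum_right mass_op_def)
  finally have "(\<Sum>i\<in>UNIV. m i *\<^sub>R v $ i) = 0"
    by (simp add: sum_force centred)
  moreover have av: "mass_op m a \<bullet> v = 0"
    using v unit by (simp add: mass_op_symmetric[of m a v] inner_diff_right inner_commute[of a])
  ultimately have "v \<in> tangent_ellipsoid m a"
    by (simp add: tangent_ellipsoid_def)
  then have "force m a \<bullet> v = 0"
    using cc by (simp add: central_configuration_def grad_potential collision_free_cc)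
  then have "mass_op m v \<bullet> v = 0"
    using av by (simp add: v inner_diff_left)
  then have "v = 0"
    using mass_op_pos by (metis less_irrefl)
  then show ?thesis
    using v by (simp add: linear_0 linear_mass_op)
qed

text \<open>In the basis \<open>a\<close>, \<open>cscale \<i> a\<close> the mass-weighted Hessian is
  \<open>multiplier\<close> times diag(-2, 1): homogeneity gives the radial entry, rotation
  invariance the other.\<close>

lemma hess_cc:
  "hess m a (cscale \<gamma> a) = mass_op m (cscale (of_real multiplier * Complex (- 2 * Re \<gamma>) (Im \<gamma>)) a)"
proof -
  have "hess m a (cscale \<gamma> a) = Re \<gamma> *\<^sub>R (- 2 *\<^sub>R force m a) + Im \<gamma> *\<^sub>R cscale \<i> (force m a)"
    by (subst cscale_decompose) (simp only: linear_add[OF linear_hess] linear_cmul[OF linear_hess] hess_self hess_rotate)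
  also have "\<dots> = cscale (Complex (- 2 * Re \<gamma>) (Im \<gamma>)) (force m a)"
    by (subst (2) cscale_decompose) (simp add: mult.commute)
  also have "\<dots> = multiplier *\<^sub>R cscale (Complex (- 2 * Re \<gamma>) (Im \<gamma>)) (mass_op m a)"
    by (subst force_cc) (simp add: linear_cmul linear_cscale)
  finally show ?thesis
    by (simp only: mass_op_cscale cscale_of_real_mult linear_cmul[OF linear_mass_op])
qed

text \<open>The Hessian at \<open>cscale c a\<close> on the complex line through \<open>a\<close>,
  with \<open>\<beta>\<close> standing for \<open>cscale \<beta> a\<close>: the operator of
  \<open>hess_cc\<close> conjugated by \<open>c\<close> and rescaled.\<close>

definition dilation_block :: "complex \<Rightarrow> complex \<Rightarrow> complex" where
  "dilation_block c \<beta> =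
     c / of_real (cmod c ^ 3) * (of_real multiplier * Complex (- 2 * Re (\<beta> / c)) (Im (\<beta> / c)))"

lemma hess_cscale_cc:
  assumes "c \<noteq> 0"
  shows "hess m (cscale c a) (cscale \<beta> a) = mass_op m (cscale (dilation_block c \<beta>) a)"
proof -
  have "hess m (cscale c a) (cscale \<beta> a) = hess m (cscale c a) (cscale c (cscale (\<beta> / c) a))"
    using assms by (simp add: cscale_cscale)
  also have "\<dots> = cscale (c / of_real (cmod c ^ 3)) (hess m a (cscale (\<beta> / c) a))"
    by (rule hess_cscale[OF assms])
  finally show ?thesis
    by (simp only: hess_cc cscale_cscale mass_op_cscale dilation_block_def)
qed

text \<open>Supplies a constant for \<open>gronwall_zero\<close> that is uniform in time. The 2 is
  the larger modulus of the entries of diag(-2, 1).\<close>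

lemma norm_dilation_block:
  assumes "0 < \<rho>" "\<rho> \<le> cmod c"
  shows "cmod (dilation_block c \<beta>) \<le> 2 * \<bar>multiplier\<bar> / \<rho> ^ 3 * cmod \<beta>"
proof -
  have c: "cmod c > 0"
    using assms by linarith
  define \<delta> where "\<delta> = Complex (- 2 * Re (\<beta> / c)) (Im (\<beta> / c))"
  have "cmod \<delta> \<le> cmod (2 * (\<beta> / c))"
    unfolding cmod_def \<delta>_def by (intro real_sqrt_le_mono) (simp add: power_mult_distrib del: times_divide_eq_right)
  then have \<delta>: "cmod \<delta> \<le> 2 * (cmod \<beta> / cmod c)"
    by (simp add: norm_mult norm_divide)
  have "cmod (dilation_block c \<beta>) = cmod c / cmod c ^ 3 * (\<bar>multiplier\<bar> * cmod \<delta>)"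
    unfolding dilation_block_def \<delta>_def[symmetric] by (simp add: norm_mult norm_divide norm_power)
  also have "\<dots> \<le> cmod c / cmod c ^ 3 * (\<bar>multiplier\<bar> * (2 * (cmod \<beta> / cmod c)))"
    by (intro mult_left_mono \<delta>) auto
  also have "\<dots> = 2 * \<bar>multiplier\<bar> * cmod \<beta> / cmod c ^ 3"
    using c by (simp add: power3_eq_cube)
  also have "\<dots> \<le> 2 * \<bar>multiplier\<bar> * cmod \<beta> / \<rho> ^ 3"
    using assms c by (intro divide_left_mono power_mono mult_pos_pos) auto
  finally show ?thesis
    by simp
qed

text \<open>With the symmetry of the Hessian, this invariance passes to the mass-orthogonal
  complement \<open>shape_space\<close>.\<close>

lemma hess_symmetry_space:
  assumes "y \<in> symmetry_space a"
  shows "\<exists>s\<in>symmetry_space a. hess m a y = mass_op m s"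
proof -
  obtain v \<alpha> where "y = (\<chi> i. v) + cscale \<alpha> a"
    using assms by (auto simp: symmetry_space_def)
  then have "hess m a y = mass_op m ((\<chi> i. 0) + cscale (of_real multiplier * Complex (- 2 * Re \<alpha>) (Im \<alpha>)) a)"
    by (simp add: linear_add[OF linear_hess] hess_translation hess_cc flip: zero_vec_def)
  then show ?thesis
    unfolding symmetry_space_def by blast
qed

lemma shape_space_nontrivial:
  assumes "v \<in> shape_space m a" "v \<noteq> 0"
  shows "v \<in> tangent_ellipsoid m a" "v \<notin> span {cscale \<i> a}"
proof -
  have orth: "mass_op m v \<bullet> ((\<chi> i. w) + cscale \<alpha> a) = 0" for w \<alpha>
    using assms by (auto simp: shape_space_def symmetry_space_def)
  have "(\<Sum>i\<in>UNIV. m i *\<^sub>R v $ i) \<bullet> w = mass_op m v \<bullet> ((\<chi> i. w) + cscale 0 a)" for w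
    by (simp add: inner_vec_def mass_op_def inner_sum_left)
  then have "(\<Sum>i\<in>UNIV. m i *\<^sub>R v $ i) = 0"
    by (metis orth inner_eq_zero_iff)
  moreover have "mass_op m v \<bullet> a = 0"
    using orth[of 0 1] by (simp flip: zero_vec_def)
  then have "mass_op m a \<bullet> v = 0"
    by (metis mass_op_symmetric inner_commute)
  ultimately show "v \<in> tangent_ellipsoid m a"
    by (simp add: tangent_ellipsoid_def)
  show "v \<notin> span {cscale \<i> a}"
  proof
    assume "v \<in> span {cscale \<i> a}"
    then obtain k where "v = (\<chi> i. 0) + cscale (of_real k * \<i>) a"
      by (auto simp: span_singleton cscale_of_real_mult simp flip: zero_vec_def)
    then have "mass_op m v \<bullet> v = 0"
      using orth by metis
    then show False
      using mass_op_pos[OF assms(2)] by simp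
  qed
qed

context
  assumes sm: "strong_minimizer m a"
begin

text \<open>The restricted Hessian is the mass-weighted Hessian shifted by
  \<open>potential m a\<close>, so the threshold in \<open>strong_minimizer\<close> says exactly
  that the unshifted eigenvalues on shape directions are positive. The Rayleigh quotient argument
  turns this into definiteness.\<close>

lemma hess_pos:
  assumes "w \<in> shape_space m a" "w \<noteq> 0"
  shows "0 < hess m a w \<bullet> w"
proof (rule positive_definite_if_eigenvalues_positive[OF linear_hess hess_symmetric
      linear_mass_op mass_op_symmetric mass_op_pos subspace_shape_space _ _ assms])
  show "\<exists>u\<in>shape_space m a. hess m a w = mass_op m u" if "w \<in> shape_space m a" for w
  proof
    have "hess m a w \<bullet> y = 0" if "y \<in> symmetry_space a" for y
      using hess_symmetry_space[OF that] \<open>w \<in> shape_space m a\<close>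
      by (auto simp: hess_symmetric shape_space_def simp flip: mass_op_symmetric)
    then show "mass_inv m (hess m a w) \<in> shape_space m a"
      by (simp add: shape_space_def mass_op_inv)
  qed (simp add: mass_op_inv)
  show "0 < \<kappa>" if "v \<in> shape_space m a" "v \<noteq> 0" "hess m a v = \<kappa> *\<^sub>R mass_op m v" for v \<kappa>
  proof -
    have "restricted_hessian m a v = mass_inv m (mass_op m (\<kappa> *\<^sub>R v)) + potential m a *\<^sub>R v"
      using that by (simp add: restricted_hessian_def hessian_potential collision_free_cc
          linear_cmul linear_mass_op)
    also have "\<dots> = (\<kappa> + potential m a) *\<^sub>R v"
      by (simp add: mass_op_inv scaleR_add_left)
    finally have "nontrivial_eigenvalue m a (\<kappa> + potential m a)"
      using shape_space_nontrivial[OF that(1,2)] by (auto simp: nontrivial_eigenvalue_def)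
    then show ?thesis
      using sm by (fastforce simp: strong_minimizer_def)
  qed
qed

text \<open>Pulling \<open>w\<close> back by \<open>c\<close> reduces to the Hessian at
  \<open>a\<close>; rotation and scaling leave only the positive factor
  \<open>1 / cmod c\<close>.\<close>

lemma hess_cscale_pos:
  assumes "w \<in> shape_space m a" "w \<noteq> 0" "c \<noteq> 0"
  shows "0 < hess m (cscale c a) w \<bullet> w"
proof -
  define u where "u = cscale (1 / c) w"
  have w: "w = cscale c u"
    using assms by (simp add: u_def cscale_cscale)
  then have "u \<in> shape_space m a" "u \<noteq> 0"
    using assms by (auto simp: u_def cscale_shape_space linear_0[OF linear_cscale])
  then have "0 < hess m a u \<bullet> u"
    by (rule hess_pos)
  have "hess m (cscale c a) w = cscale (of_real (1 / cmod c ^ 3) * c) (hess m a u)"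
    using hess_cscale[OF assms(3)] by (simp add: w)
  also have "\<dots> = (1 / cmod c ^ 3) *\<^sub>R cscale c (hess m a u)"
    by (rule cscale_of_real_mult)
  finally have "hess m (cscale c a) w \<bullet> w = (cmod c)\<^sup>2 / cmod c ^ 3 * (hess m a u \<bullet> u)"
    by (simp add: w inner_cscale)
  with \<open>0 < hess m a u \<bullet> u\<close> assms show ?thesis
    by simp
qed

end

end

end

subsection \<open>The linearized flow on the shape directions\<close>

text \<open>Test vectors with one component zero separate the conditions on position and
  momentum.\<close>

lemma E3_orthogonal:
  assumes "X \<in> E3 m a"
  shows "fst X \<bullet> mass_op m (\<chi> i. v) = 0" "snd X \<bullet> (\<chi> i. v) = 0"
    and "fst X \<bullet> mass_op m (cscale \<alpha> a) = 0" "snd X \<bullet> cscale \<alpha> a = 0"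
proof -
  have orth: "fst X \<bullet> snd Y - snd X \<bullet> fst Y = 0" if "Y \<in> E1 m \<union> E2 m a" for Y
    using assms that by (auto simp: E3_def symplectic_form_def)
  have 0: "mass_op m 0 = 0" "(\<chi> i. 0) = (0 :: 'a config)"
    by (simp_all add: linear_0 linear_mass_op vec_eq_iff)
  have "((\<chi> i. 0), mass_op m (\<chi> i. v)) \<in> E1 m" "((\<chi> i. v), mass_op m (\<chi> i. 0)) \<in> E1 m"
    unfolding E1_def by blast+
  from this[THEN UnI1, THEN orth]
  show "fst X \<bullet> mass_op m (\<chi> i. v) = 0" "snd X \<bullet> (\<chi> i. v) = 0"
    by (simp_all add: 0)
  have "(cscale 0 a, mass_op m (cscale \<alpha> a)) \<in> E2 m a" "(cscale \<alpha> a, mass_op m (cscale 0 a)) \<in> E2 m a"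
    unfolding E2_def by blast+
  from this[THEN UnI2, THEN orth]
  show "fst X \<bullet> mass_op m (cscale \<alpha> a) = 0" "snd X \<bullet> cscale \<alpha> a = 0"
    by (simp_all add: 0)
qed

lemma has_real_derivative_inner_const:
  assumes "(f has_vector_derivative f') (at t)"
  shows "((\<lambda>s. f s \<bullet> y) has_real_derivative f' \<bullet> y) (at t)"
  using bounded_linear.has_vector_derivative[OF bounded_linear_inner_left assms]
  by (simp add: has_real_derivative_iff_has_vector_derivative)

lemma has_vector_derivative_Complex:
  assumes "(f has_real_derivative f') (at t)" "(g has_real_derivative g') (at t)"
  shows "((\<lambda>s. Complex (f s) (g s)) has_vector_derivative Complex f' g') (at t)"
  using assms unfolding has_vector_derivative_complex_iff
  by (simp add: has_real_derivative_iff_has_vector_derivative)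

text \<open>Pairing a solution with the symmetry directions gives closed linear equations, and
  \<open>E3\<close> makes their initial data zero. Translations are integrated directly; the complex
  line of \<open>a\<close> is left to \<open>gronwall_zero\<close>.\<close>

lemma E3_flow_in_shape_space:
  assumes m: "\<And>i. m i > 0" and cc: "central_configuration m a"
    and \<rho>: "0 < \<rho>" "\<And>t. \<rho> \<le> cmod (c t)" and q: "\<And>t. q t = cscale (c t) a"
    and X: "\<And>t. (X has_vector_derivative linearized_field m q t (X t)) (at t)"
    and X0: "X 0 \<in> E3 m a" and t: "0 \<le> t"
  shows "fst (X t) \<in> shape_space m a"
proof -
  define \<xi> \<eta> where "\<xi> s = fst (X s)" and "\<eta> s = snd (X s)" for s
  have c: "c s \<noteq> 0" for s
    using \<rho>(1) \<rho>(2)[of s] by auto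
  have field: "linearized_field m q s (X s) = (mass_inv m (\<eta> s), hess m (q s) (\<xi> s))" for s
    by (simp add: linearized_field_def case_prod_unfold \<xi>_def \<eta>_def q
        hessian_potential collision_free_cscale[OF m cc c])
  have \<xi>': "(\<xi> has_vector_derivative mass_inv m (\<eta> s)) (at s)" for s
    using bounded_linear.has_vector_derivative[OF bounded_linear_fst X, of s]
    by (simp add: \<xi>_def[abs_def] field)
  have \<eta>': "(\<eta> has_vector_derivative hess m (q s) (\<xi> s)) (at s)" for s
    using bounded_linear.has_vector_derivative[OF bounded_linear_snd X, of s]
    by (simp add: \<eta>_def[abs_def] field)
  have \<xi>y: "((\<lambda>s. \<xi> s \<bullet> mass_op m y) has_real_derivative \<eta> s \<bullet> y) (at s)" for s y
    using has_real_derivative_inner_const[OF \<xi>'[of s], of "mass_op m y"]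
    by (simp add: mass_inv_inner_mass_op[OF m])
  have \<eta>y: "((\<lambda>s. \<eta> s \<bullet> y) has_real_derivative \<xi> s \<bullet> hess m (q s) y) (at s)" for s y
    using has_real_derivative_inner_const[OF \<eta>'[of s], of y] by (simp add: hess_symmetric)
  note start = E3_orthogonal[OF X0, folded \<xi>_def \<eta>_def]

  \<comment> \<open>Total momentum is conserved, hence 0; only then is the centre of mass
    constant.\<close>
  have "\<eta> s \<bullet> (\<chi> i. v) = 0" for s v
    using DERIV_isconst_all[of "\<lambda>s. \<eta> s \<bullet> (\<chi> i. v)" s 0] \<eta>y[of "\<chi> i. v"] start
    by (simp add: hess_translation)
  then have translation: "\<xi> s \<bullet> mass_op m (\<chi> i. v) = 0" for s v
    using DERIV_isconst_all[of "\<lambda>s. \<xi> s \<bullet> mass_op m (\<chi> i. v)" s 0] \<xi>y[of "\<chi> i. v"] start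
    by simp

  define L where "L s = dilation_block m a (c s)" for s
  \<comment> \<open>\<open>Z\<close> and \<open>Y\<close> pack the two real pairings of position and
    momentum with \<open>a\<close> and \<open>cscale \<i> a\<close> into complex numbers, so that
    \<open>\<beta> \<bullet> Z s\<close> is the pairing with
    \<open>cscale \<beta> a\<close>.\<close>
  define Z where "Z s = Complex (\<xi> s \<bullet> mass_op m (cscale 1 a)) (\<xi> s \<bullet> mass_op m (cscale \<i> a))" for s
  define Y where "Y s = Complex (\<eta> s \<bullet> cscale 1 a) (\<eta> s \<bullet> cscale \<i> a)" for s
  have Z: "\<xi> s \<bullet> mass_op m (cscale \<beta> a) = \<beta> \<bullet> Z s" for s \<beta>
    by (subst cscale_decompose)
      (simp add: Z_def inner_complex_def linear_add linear_cmul linear_mass_op inner_add_right)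
  have "(Z has_vector_derivative Y s) (at s)" for s
    unfolding Z_def[abs_def] Y_def by (intro has_vector_derivative_Complex \<xi>y)
  moreover have "(Y has_vector_derivative Complex (L s 1 \<bullet> Z s) (L s \<i> \<bullet> Z s)) (at s)" for s
  proof -
    have "((\<lambda>s. \<eta> s \<bullet> cscale \<beta> a) has_real_derivative L s \<beta> \<bullet> Z s) (at s)" for \<beta>
      using \<eta>y[of "cscale \<beta> a" s] by (simp add: q L_def Z hess_cscale_cc[OF m cc c])
    then show ?thesis
      unfolding Y_def[abs_def] by (intro has_vector_derivative_Complex)
  qed
  ultimately have "((\<lambda>s. (Z s, Y s)) has_vector_derivative
      (Y s, Complex (L s 1 \<bullet> Z s) (L s \<i> \<bullet> Z s))) (at s)" for s
    by (intro has_vector_derivative_Pair)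
  moreover
  define K where "K = 2 * \<bar>force m a \<bullet> a\<bar> / \<rho> ^ 3"
  have "K \<ge> 0"
    using \<rho> by (simp add: K_def)
  \<comment> \<open>The velocity \<open>Y s\<close> accounts for the 1, and each of the two real
    components of the acceleration for one \<open>K\<close>.\<close>
  have "norm (Y s, Complex (L s 1 \<bullet> Z s) (L s \<i> \<bullet> Z s)) \<le> (1 + 2 * K) * norm (Z s, Y s)" for s
  proof -
    have "\<bar>L s \<beta> \<bullet> Z s\<bar> \<le> K * norm (Z s)" if "norm \<beta> = 1" for \<beta>
    proof -
      have "\<bar>L s \<beta> \<bullet> Z s\<bar> \<le> norm (L s \<beta>) * norm (Z s)"
        by (rule Cauchy_Schwarz_ineq2)
      also have "\<dots> \<le> K * norm (Z s)"
        using norm_dilation_block[OF m cc \<rho>(1) \<rho>(2), of s \<beta>] that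
        by (intro mult_right_mono) (simp_all add: K_def L_def)
      finally show ?thesis .
    qed
    from this[of 1] this[of \<i>] have "norm (Complex (L s 1 \<bullet> Z s) (L s \<i> \<bullet> Z s)) \<le> 2 * K * norm (Z s)"
      using cmod_le[of "Complex (L s 1 \<bullet> Z s) (L s \<i> \<bullet> Z s)"] by simp
    moreover have "norm (Y s, Complex (L s 1 \<bullet> Z s) (L s \<i> \<bullet> Z s))
        \<le> norm (Y s) + norm (Complex (L s 1 \<bullet> Z s) (L s \<i> \<bullet> Z s))"
      by (rule norm_Pair_le)
    moreover have "norm (Y s) \<le> norm (Z s, Y s)" "norm (Z s) \<le> norm (Z s, Y s)"
      using norm_snd_le[of "Y s" "Z s"] norm_fst_le[of "Z s" "Y s"] by auto
    moreover have "2 * K * norm (Z s) \<le> 2 * K * norm (Z s, Y s)"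
      using \<open>K \<ge> 0\<close> calculation(4) by (intro mult_left_mono) auto
    ultimately show ?thesis
      unfolding distrib_right by linarith
  qed
  moreover have "(Z 0, Y 0) = 0"
    \<comment> \<open>\<open>cscale_1\<close> is switched off so that \<open>cscale 1 a\<close>
      still matches the facts \<open>start\<close>.\<close>
    using start unfolding Z_def Y_def by (simp add: complex_eq_iff zero_prod_def del: cscale_1)
  ultimately have "(Z t, Y t) = 0"
    using t by (rule gronwall_zero)
  then have "Z t = 0"
    by (simp add: zero_prod_def)
  then have "\<xi> t \<bullet> mass_op m ((\<chi> i. v) + cscale \<beta> a) = 0" for v \<beta>
    using translation Z by (simp add: linear_add linear_mass_op inner_add_right)
  then show ?thesis
    by (auto simp: shape_space_def symmetry_space_def mass_op_symmetric \<xi>_def)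
qed

text \<open>The derivative of position times momentum is a kinetic term plus the Hessian form, the
  latter nonnegative because the position stays in \<open>shape_space\<close>. If
  \<open>X t \<noteq> 0\<close>, one of its components is nonzero and the corresponding term is
  strictly positive.\<close>

lemma E3_flow_virial:
  assumes m: "\<And>i. m i > 0" and cc: "central_configuration m a" and sm: "strong_minimizer m a"
    and \<rho>: "0 < \<rho>" "\<And>t. \<rho> \<le> cmod (c t)" and q: "\<And>t. q t = cscale (c t) a"
    and X: "\<And>t. (X has_vector_derivative linearized_field m q t (X t)) (at t)"
    and X0: "X 0 \<in> E3 m a" and t: "0 \<le> t"
  obtains d where "((\<lambda>s. fst (X s) \<bullet> snd (X s)) has_real_derivative d) (at t)"
    and "0 \<le> d" and "X t \<noteq> 0 \<Longrightarrow> 0 < d"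
proof
  define \<xi> \<eta> where "\<xi> = fst (X t)" and "\<eta> = snd (X t)"
  have c: "c t \<noteq> 0"
    using \<rho>(1) \<rho>(2)[of t] by auto
  have field: "linearized_field m q t (X t) = (mass_inv m \<eta>, hess m (cscale (c t) a) \<xi>)"
    by (simp add: linearized_field_def case_prod_unfold \<xi>_def \<eta>_def q
        hessian_potential collision_free_cscale[OF m cc c])
  let ?d = "mass_inv m \<eta> \<bullet> \<eta> + hess m (cscale (c t) a) \<xi> \<bullet> \<xi>"
  show "((\<lambda>s. fst (X s) \<bullet> snd (X s)) has_real_derivative ?d) (at t)"
    using bounded_bilinear.has_vector_derivative[OF bounded_bilinear_inner
        bounded_linear.has_vector_derivative[OF bounded_linear_fst X[of t]]
        bounded_linear.has_vector_derivative[OF bounded_linear_snd X[of t]]]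
    by (simp add: field has_real_derivative_iff_has_vector_derivative inner_commute add.commute
        flip: \<xi>_def \<eta>_def)
  have \<xi>: "\<xi> \<in> shape_space m a"
    unfolding \<xi>_def by (rule E3_flow_in_shape_space[OF m cc \<rho> q X X0 t])
  have hess: "0 < hess m (cscale (c t) a) \<xi> \<bullet> \<xi>" if "\<xi> \<noteq> 0"
    by (rule hess_cscale_pos[OF m cc sm \<xi> that c])
  then have hess0: "0 \<le> hess m (cscale (c t) a) \<xi> \<bullet> \<xi>"
    by (cases "\<xi> = 0") auto
  show "0 \<le> ?d"
    using hess0 mass_inv_nonneg[where m = m and x = \<eta>, OF m] by simp
  show "0 < ?d" if "X t \<noteq> 0"
  proof (cases "\<xi> = 0")
    case True
    then have "\<eta> \<noteq> 0"
      using that by (auto simp: \<xi>_def \<eta>_def prod_eq_iff)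
    then show ?thesis
      using mass_inv_pos[where m = m and x = \<eta>, OF m] hess0 by (simp add: add_pos_nonneg)
  next
    case False
    then show ?thesis
      using hess mass_inv_nonneg[where m = m and x = \<eta>, OF m] by (simp add: add_nonneg_pos)
  qed
qed

text \<open>The real part of the Hermitian product of \<open>x + i y\<close> and
  \<open>x' + i y'\<close>, after both vectors are multiplied by \<open>c\<close>.\<close>

lemma inner_add_inner_rotate:
  "(Re c *\<^sub>R x - Im c *\<^sub>R y) \<bullet> (Re c *\<^sub>R x' - Im c *\<^sub>R y')
    + (Im c *\<^sub>R x + Re c *\<^sub>R y) \<bullet> (Im c *\<^sub>R x' + Re c *\<^sub>R y') = (cmod c)\<^sup>2 * (x \<bullet> x' + y \<bullet> y')"
  unfolding cmod_power2
  by (simp add: inner_add_left inner_add_right inner_diff_left inner_diff_right algebra_simps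
      power2_eq_square)

theorem theorem1p4:
  fixes m :: "'n::{finite,linorder} \<Rightarrow> real" and a :: "(complex, 'n) vec"
    and e T :: real and q :: "real \<Rightarrow> (complex, 'n) vec"
  assumes "CARD('n) \<ge> 3"
    and "\<And>i. m i > 0"
    and "central_configuration m a"
    and "strong_minimizer m a"
    and "0 \<le> e" and "e < 1"
    and "elliptic_relative_equilibrium m a e T q"
  shows "hyperbolic m a T q"
proof -
  note m = assms(2) and cc = assms(3) and sm = assms(4)
  obtain p \<theta> where p: "p > 0" and T: "T > 0"
    and q: "\<And>t. q t = cscale (of_real (p / (1 + e * cos (\<theta> t))) * cis (\<theta> t)) a"
    using assms(7) by (auto simp: elliptic_relative_equilibrium_def)
  define c where "c t = of_real (p / (1 + e * cos (\<theta> t))) * cis (\<theta> t)" for t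
  \<comment> \<open>The pericentre distance of the ellipse, which keeps the motion uniformly away
    from total collapse.\<close>
  define \<rho> where "\<rho> = p / (1 + e)"
  have \<rho>: "0 < \<rho>"
    using p assms(5) by (simp add: \<rho>_def)
  have \<rho>c: "\<rho> \<le> cmod (c t)" for t
  proof -
    have "\<bar>e * cos (\<theta> t)\<bar> \<le> e"
      using assms(5) by (simp add: abs_mult mult_left_le)
    then have "0 < 1 + e * cos (\<theta> t)" "1 + e * cos (\<theta> t) \<le> 1 + e"
      using assms(6) by linarith+
    then show ?thesis
      using p by (simp add: \<rho>_def c_def norm_mult norm_divide frac_le flip: of_real_add of_real_mult)
  qed
  show ?thesis
    unfolding hyperbolic_def
  proof (intro allI impI notI)
    fix \<Phi> z
    assume fund: "fundamental_solution (linearized_field m q) \<Phi>"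
      and "complex_eigenvalue_on (E3 m a) (\<Phi> T) z" and z: "cmod z = 1"
    then obtain x y where E3: "x \<in> E3 m a" "y \<in> E3 m a" and nz: "x \<noteq> 0 \<or> y \<noteq> 0"
      and \<Phi>T: "\<Phi> T x = Re z *\<^sub>R x - Im z *\<^sub>R y" "\<Phi> T y = Im z *\<^sub>R x + Re z *\<^sub>R y"
      by (auto simp: complex_eigenvalue_on_def)
    \<comment> \<open>The real part of the Hermitian pairing of position and momentum along the
      complex solution that starts at the eigenvector \<open>x + i y\<close>.\<close>
    define f where "f s = fst (\<Phi> s x) \<bullet> snd (\<Phi> s x) + fst (\<Phi> s y) \<bullet> snd (\<Phi> s y)" for s
    have \<Phi>0: "\<Phi> 0 u = u" for u
      using fund unfolding fundamental_solution_def by blast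
    have flow: "((\<lambda>s. \<Phi> s u) has_vector_derivative linearized_field m q t (\<Phi> t u)) (at t)" for u t
      using fund unfolding fundamental_solution_def by blast
    have virial: "\<exists>d. (f has_real_derivative d) (at t) \<and> 0 \<le> d \<and> (\<Phi> t x \<noteq> 0 \<or> \<Phi> t y \<noteq> 0 \<longrightarrow> 0 < d)"
      if "0 \<le> t" for t
    proof -
      note virial = E3_flow_virial[OF m cc sm \<rho> \<rho>c q[folded c_def] flow _ that]
      obtain d1 where "((\<lambda>s. fst (\<Phi> s x) \<bullet> snd (\<Phi> s x)) has_real_derivative d1) (at t)"
        "0 \<le> d1" "\<Phi> t x \<noteq> 0 \<Longrightarrow> 0 < d1"
        by (rule virial[of x]) (auto simp: \<Phi>0 E3)
      moreover obtain d2 where "((\<lambda>s. fst (\<Phi> s y) \<bullet> snd (\<Phi> s y)) has_real_derivative d2) (at t)"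
        "0 \<le> d2" "\<Phi> t y \<noteq> 0 \<Longrightarrow> 0 < d2"
        by (rule virial[of y]) (auto simp: \<Phi>0 E3)
      ultimately show ?thesis
        unfolding f_def[abs_def]
        by (intro exI[of _ "d1 + d2"]) (auto intro: DERIV_add add_pos_nonneg add_nonneg_pos)
    qed
    \<comment> \<open>Strict growth is used only at time 0, where the eigenvector is nonzero;
      afterwards monotonicity suffices, so solutions need not be shown to stay nonzero.\<close>
    obtain d where "(f has_real_derivative d) (at 0)" "0 < d"
      using virial[of 0] nz \<Phi>0 by auto
    from DERIV_pos_inc_right[OF this] obtain \<epsilon> where "\<epsilon> > 0" and
      inc: "\<And>h. 0 < h \<Longrightarrow> h < \<epsilon> \<Longrightarrow> f 0 < f h"
      by auto
    define h where "h = min (\<epsilon> / 2) T"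
    have h: "0 < h" "h < \<epsilon>" "h \<le> T"
      using \<open>\<epsilon> > 0\<close> T by (auto simp: h_def)
    have "f h \<le> f T"
    proof (rule DERIV_nonneg_imp_nondecreasing[OF h(3)])
      show "\<exists>d. (f has_real_derivative d) (at s) \<and> 0 \<le> d" if "h \<le> s" for s
        using virial[of s] that h(1) by auto
    qed
    with inc[OF h(1,2)] have "f 0 < f T"
      by simp
    \<comment> \<open>Over one period the complex solution is multiplied by \<open>z\<close>, so on
      the unit circle \<open>f\<close> would return to its initial value.\<close>
    moreover have "f T = (cmod z)\<^sup>2 * f 0"
      unfolding f_def \<Phi>T \<Phi>0 fst_add snd_add fst_diff snd_diff fst_scaleR snd_scaleR
      by (rule inner_add_inner_rotate)
    ultimately show False
      using z by simp
  qed
qed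

end
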